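(* Let $X\in\mathbb{R}^{n\times p}$ and let the penalty $h:\mathbb{R}^p\to[0,+\infty)$ be a seminorm. For $\beta^*\in\mathbb{R}^p$ let $y=X\beta^*+\varepsilon$, let $\hat\beta\in\operatorname{argmin}_{\beta\in\mathbb{R}^p}\{\|X\beta-y\|^2+2h(\beta)\}$, and let $\mathrm{LSB}(\beta^* )$ be the large signal bias of $\beta^*$. It is assumed throughout that $\beta^*$ has minimal $h$-seminorm, i.e. that $\beta^*$ is a solution of the problem $\min_{\beta\in\mathbb{R}^p:\,X\beta=X\beta^*}h(\beta)$. The large signal bias enjoys the following properties. (1) For any $\beta^*\ne0$, $h(\beta^* )/\|X\beta^*\|\le\mathrm{LSB}(\beta^* )<+\infty$ provided that $\beta^*$ is a solution of the problem $\min_{\beta\in\mathbb{R}^p:\,X\beta=X\beta^*}h(\beta)$. (2) For any nonzero scalar $t\in\mathbb{R}$, $\mathrm{LSB}(t\beta^* )=\mathrm{LSB}(\beta^* )$. (3) For any small $\gamma>0$, if $X$ is deterministic, if the noise satisfies $\mathbb{E}[\varepsilon]=0$ and $\mathbb{E}[\|\varepsilon\|^2]<+\infty$, and if $\|X\beta^*\|$ is large enough, then $$(1-\gamma)\,\mathrm{LSB}(\beta^* )\le\mathbb{E}\bigl[\|X(\hat\beta-\beta^* )\|\bigr].$$ (4) In the noiseless setting ($\varepsilon=0$), $\|X(\hat\beta-\beta^* )\|\le\mathrm{LSB}(\beta^* )$ for any $\beta^*\in\mathbb{R}^p$. (5) If the penalty function $h$ is of the form $h(\cdot)=\lambda N(\cdot)$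 for some norm $N(\cdot)$ and $\lambda\ge0$, then $\mathrm{LSB}(\beta^* )$ is increasing with respect to $\lambda$.
   Context: $\|\cdot\|$ is the Euclidean norm. A seminorm $h$ on $\mathbb{R}^p$ is a nonnegative function satisfying the triangle inequality and $h(a\beta)=|a|h(\beta)$ for all $a\in\mathbb{R}$, $\beta\in\mathbb{R}^p$. In the linear model $y=X\beta^*+\varepsilon$, the vector $\varepsilon\in\mathbb{R}^n$ is the noise. The large signal bias (for the penalty $h$ and the design $X$) of a vector $\beta^*\neq0$ is $$\mathrm{LSB}(\beta^* )=\sup_{\beta\in\mathbb{R}^p:\ X\beta\ne X\beta^*}\frac{h(\beta^* )-h(\beta)}{\|X(\beta^*-\beta)\|},$$ with the convention $\mathrm{LSB}(\beta^* )=0$ for $\beta^*=0$.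
   Formalization: In (3) the threshold for ‖Xβ*‖ may depend on the direction of β* (a uniform one fails, e.g. X = I, h the l1-norm). In (4) nonzero β* with Xβ* = 0 is excluded, since LSB can be negative there; the lower bound in (1) is claimed only for Xβ* ≠ 0. *)

theory Defs
  imports "HOL-Probability.Probability"
begin

definition is_seminorm :: "(real ^ 'p \<Rightarrow> real) \<Rightarrow> bool" where
  "is_seminorm h \<longleftrightarrow>
     (\<forall>b. 0 \<le> h b) \<and>
     (\<forall>b c. h (b + c) \<le> h b + h c) \<and>
     (\<forall>a b. h (a *\<^sub>R b) = \<bar>a\<bar> * h b)"

definition is_norm :: "(real ^ 'p \<Rightarrow> real) \<Rightarrow> bool" where
  "is_norm N \<longleftrightarrow> is_seminorm N \<and> (\<forall>b. N b = 0 \<longrightarrow> b = 0)"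

(* The supremum is taken in the extended reals, so that its finiteness is a genuine claim;
   the supremum of the empty set, which occurs only for X = 0, is minus infinity. *)
definition LSB :: "real ^ 'p ^ 'n \<Rightarrow> (real ^ 'p \<Rightarrow> real) \<Rightarrow> real ^ 'p \<Rightarrow> ereal" where
  "LSB X h bs =
     (if bs = 0 then 0
      else (SUP b \<in> {b. X *v b \<noteq> X *v bs}. ereal ((h bs - h b) / norm (X *v (bs - b)))))"

definition minimal_seminorm :: "real ^ 'p ^ 'n \<Rightarrow> (real ^ 'p \<Rightarrow> real) \<Rightarrow> real ^ 'p \<Rightarrow> bool" where
  "minimal_seminorm X h bs \<longleftrightarrow> is_arg_min h (\<lambda>b. X *v b = X *v bs) bs"

definition penalized_estimator ::
    "real ^ 'p ^ 'n \<Rightarrow> (real ^ 'p \<Rightarrow> real) \<Rightarrow> real ^ 'n \<Rightarrow> real ^ 'p \<Rightarrow> bool" where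
  "penalized_estimator X h y bh \<longleftrightarrow>
     is_arg_min (\<lambda>b. (norm (X *v b - y))\<^sup>2 + 2 * h b) (\<lambda>_. True) bh"

end

theory Submission
  imports Defs
begin

text \<open>Minimality of \<open>bs\<close> makes \<open>bs\<close> comparable with \<open>b + g (X *v (bs - b))\<close> for a linear right
  inverse \<open>g\<close> of \<open>X\<close> on its range, so \<open>h bs - h b\<close> is at most a constant \<open>L\<close> times
  \<open>norm (X *v (bs - b))\<close>; this is the finiteness of the bias.  The rest follows from the variational
  inequality \<open>(y - X *v bh) \<bullet> (X *v (b - bh)) \<le> h b - h bh\<close>.  For \<open>y = X *v bs\<close> and \<open>b = bs\<close> it is
  the noiseless bound.  With centred noise \<open>\<epsilon>\<close> and \<open>D = X *v (bh - bs)\<close>, it bounds \<open>h bs - h b\<close>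
  by \<open>(D - \<epsilon>) \<bullet> (X *v (b - bs)) + (L + norm \<epsilon>) * norm D - (norm D)\<^sup>2\<close>, where the last two terms
  are at most \<open>L\<^sup>2 + (norm \<epsilon>)\<^sup>2\<close>.  After taking expectations, this error does not depend on
  \<open>bs\<close> and \<open>b\<close>, whereas \<open>h bs - h b\<close> and \<open>X *v (b - bs)\<close> grow linearly when \<open>bs\<close> and a
  nearly optimal \<open>b\<close> in the definition of the bias are scaled together.\<close>

section \<open>Seminorms and minimal representatives of a fibre of \<open>X\<close>\<close>

lemma seminormD:
  assumes "is_seminorm h"
  shows seminorm_nonneg: "0 \<le> h b"
    and seminorm_triangle: "h (b + c) \<le> h b + h c"
    and seminorm_scale: "h (a *\<^sub>R b) = \<bar>a\<bar> * h b"
  using assms unfolding is_seminorm_def by auto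

lemma seminorm_zero:
  assumes "is_seminorm h"
  shows "h 0 = 0"
  using seminorm_scale[OF assms, of 0 0] by simp

lemma seminorm_sum_le:
  assumes "is_seminorm h" "finite A"
  shows "h (\<Sum>i\<in>A. f i) \<le> (\<Sum>i\<in>A. h (f i))"
  using assms(2)
proof (induction A rule: finite_induct)
  case empty
  then show ?case using seminorm_zero[OF assms(1)] by simp
next
  case (insert x A)
  then show ?case using seminorm_triangle[OF assms(1), of "f x" "sum f A"] by simp
qed

lemma seminorm_bounded:
  fixes h :: "real ^ 'p \<Rightarrow> real"
  assumes "is_seminorm h"
  obtains C where "0 \<le> C" "\<And>b. h b \<le> C * norm b"
proof
  show "0 \<le> (\<Sum>i\<in>Basis. h i)"
    by (intro sum_nonneg seminorm_nonneg[OF assms])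
  fix b :: "real ^ 'p"
  have "h b = h (\<Sum>i\<in>Basis. (b \<bullet> i) *\<^sub>R i)"
    by (simp add: euclidean_representation)
  also have "\<dots> \<le> (\<Sum>i\<in>Basis. \<bar>b \<bullet> i\<bar> * h i)"
    using seminorm_sum_le[OF assms finite_Basis, of "\<lambda>i. (b \<bullet> i) *\<^sub>R i"]
    by (simp add: seminorm_scale[OF assms])
  also have "\<dots> \<le> (\<Sum>i\<in>Basis. norm b * h i)"
    by (intro sum_mono mult_right_mono Basis_le_norm seminorm_nonneg[OF assms])
  finally show "h b \<le> (\<Sum>i\<in>Basis. h i) * norm b"
    by (simp add: sum_distrib_left mult.commute)
qed

lemma minimal_seminorm_iff:
  "minimal_seminorm X h bs \<longleftrightarrow> (\<forall>b. X *v b = X *v bs \<longrightarrow> h bs \<le> h b)"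
  unfolding minimal_seminorm_def is_arg_min_def by (auto simp: not_less)

text \<open>Lets a near-optimal competitor be chosen once, at \<open>v\<close>, for all minimal
  vectors on the line through \<open>v\<close>.\<close>

lemma minimal_seminorm_scaleR:
  assumes "is_seminorm h" "minimal_seminorm X h (t *\<^sub>R v)" "t \<noteq> 0"
  shows "minimal_seminorm X h v"
  unfolding minimal_seminorm_iff
proof (intro allI impI)
  fix b assume "X *v b = X *v v"
  then have "X *v (t *\<^sub>R b) = X *v (t *\<^sub>R v)"
    by (simp add: matrix_vector_mult_scaleR)
  then have "h (t *\<^sub>R v) \<le> h (t *\<^sub>R b)"
    using assms(2) unfolding minimal_seminorm_iff by blast
  then show "h v \<le> h b"
    using assms(3) by (simp add: seminorm_scale[OF assms(1)])
qed

text \<open>The right inverse and the bound on \<open>h\<close> depend on \<open>X\<close> and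
  \<open>h\<close> only, so one \<open>L\<close> serves all minimal \<open>bs\<close>. This
  uniformity keeps the error term of the risk bound independent of the signal size.\<close>

lemma minimal_seminorm_lipschitz:
  fixes X :: "real ^ 'p ^ 'n"
  assumes "is_seminorm h"
  obtains L where "0 \<le> L"
    "\<And>bs b. minimal_seminorm X h bs \<Longrightarrow> h bs - h b \<le> L * norm (X *v (bs - b))"
proof -
  obtain C where C: "0 \<le> C" "\<And>b. h b \<le> C * norm b"
    using seminorm_bounded[OF assms] by blast
  obtain g :: "real ^ 'n \<Rightarrow> real ^ 'p"
    where g: "linear g" "\<And>b. X *v g (X *v b) = X *v b"
    using linear_exists_right_inverse_on[OF matrix_vector_mul_linear[of X] subspace_UNIV]
    by auto
  obtain B where B: "B > 0" "\<And>z. norm (g z) \<le> B * norm z"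
    using linear_bounded_pos[OF g(1)] by blast
  show thesis
  proof
    show "0 \<le> C * B" using C(1) B(1) by simp
    fix bs b assume m: "minimal_seminorm X h bs"
    define u where "u = g (X *v (bs - b))"
    have "X *v u = X *v (bs - b)" by (simp only: u_def g(2))
    then have "X *v (b + u) = X *v bs"
      by (simp add: matrix_vector_mult_diff_distrib matrix_vector_right_distrib)
    then have "h bs \<le> h (b + u)"
      using m unfolding minimal_seminorm_iff by blast
    also have "\<dots> \<le> h b + h u" by (rule seminorm_triangle[OF assms])
    also have "h u \<le> C * (B * norm (X *v (bs - b)))"
      using C(2)[of u] mult_left_mono[OF B(2)[of "X *v (bs - b)"] C(1)]
      unfolding u_def by linarith
    finally show "h bs - h b \<le> C * B * norm (X *v (bs - b))" by simp
  qed
qed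

section \<open>The large signal bias: lower bound, finiteness, scaling\<close>

lemma LSB_upper:
  assumes "bs \<noteq> 0" "X *v b \<noteq> X *v bs"
  shows "ereal ((h bs - h b) / norm (X *v (bs - b))) \<le> LSB X h bs"
  using assms unfolding LSB_def by (auto intro!: SUP_upper)

text \<open>The competitor \<open>b = 0\<close> has exactly this quotient.\<close>

lemma LSB_ge_ratio:
  assumes "is_seminorm h" "X *v bs \<noteq> 0"
  shows "ereal (h bs / norm (X *v bs)) \<le> LSB X h bs"
  using LSB_upper[of bs X 0 h] assms seminorm_zero[OF assms(1)]
  by (cases "bs = 0") auto

lemma LSB_nonneg:
  assumes "is_seminorm h" "X *v bs \<noteq> 0"
  shows "0 \<le> LSB X h bs"
proof -
  have "0 \<le> ereal (h bs / norm (X *v bs))"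
    using seminorm_nonneg[OF assms(1)] by simp
  then show ?thesis using LSB_ge_ratio[OF assms] by (rule order_trans)
qed

lemma LSB_finite:
  fixes X :: "real ^ 'p ^ 'n"
  assumes "is_seminorm h" "minimal_seminorm X h bs"
  shows "LSB X h bs < \<infinity>"
proof (cases "bs = 0")
  case False
  obtain L where L: "\<And>b. h bs - h b \<le> L * norm (X *v (bs - b))"
    using minimal_seminorm_lipschitz[OF assms(1)] assms(2) by metis
  have "LSB X h bs \<le> ereal L"
    using False L unfolding LSB_def
    by (auto intro!: SUP_least simp: divide_le_eq matrix_vector_mult_diff_distrib)
  then show ?thesis using less_ereal.simps(4) order_le_less_trans by blast
qed (simp add: LSB_def)

text \<open>The map \<open>b\<close> to \<open>t *\<^sub>R b\<close> carries the competitors of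
  \<open>bs\<close> onto those of \<open>t *\<^sub>R bs\<close>, and the factor
  \<open>\<bar>t\<bar>\<close> cancels in each quotient.\<close>

lemma LSB_scaleR:
  fixes X :: "real ^ 'p ^ 'n"
  assumes "is_seminorm h" "t \<noteq> 0"
  shows "LSB X h (t *\<^sub>R bs) = LSB X h bs"
proof (cases "bs = 0")
  case False
  have "{b. X *v b \<noteq> X *v (t *\<^sub>R bs)} = (\<lambda>b. t *\<^sub>R b) ` {b. X *v b \<noteq> X *v bs}"
  proof (intro set_eqI iffI)
    fix b assume "b \<in> {b. X *v b \<noteq> X *v (t *\<^sub>R bs)}"
    then have "X *v (t *\<^sub>R ((1 / t) *\<^sub>R b)) \<noteq> X *v (t *\<^sub>R bs)"
      using assms(2) by simp
    then have "X *v ((1 / t) *\<^sub>R b) \<noteq> X *v bs"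
      by (metis matrix_vector_mult_scaleR)
    moreover have "b = t *\<^sub>R ((1 / t) *\<^sub>R b)" using assms(2) by simp
    ultimately show "b \<in> (\<lambda>b. t *\<^sub>R b) ` {b. X *v b \<noteq> X *v bs}" by blast
  qed (use assms(2) in \<open>auto simp: matrix_vector_mult_scaleR\<close>)
  moreover have "(h (t *\<^sub>R bs) - h (t *\<^sub>R b)) / norm (X *v (t *\<^sub>R bs - t *\<^sub>R b))
      = (h bs - h b) / norm (X *v (bs - b))" for b
  proof -
    have "X *v (t *\<^sub>R bs - t *\<^sub>R b) = t *\<^sub>R (X *v (bs - b))"
      by (simp add: matrix_vector_mult_scaleR flip: scaleR_diff_right)
    moreover have "h (t *\<^sub>R bs) - h (t *\<^sub>R b) = \<bar>t\<bar> * (h bs - h b)"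
      by (simp add: seminorm_scale[OF assms(1)] algebra_simps)
    ultimately show ?thesis using assms(2) by simp
  qed
  ultimately show ?thesis
    using False assms(2) by (simp add: LSB_def image_image)
qed simp

lemma LSB_cmult:
  assumes "bs \<noteq> 0" "X *v bs \<noteq> 0" "0 \<le> l"
  shows "LSB X (\<lambda>b. l * N b) bs = ereal l * LSB X N bs"
proof -
  let ?A = "{b. X *v b \<noteq> X *v bs}"
  \<comment> \<open>Over an empty set the supremum is minus infinity, and for \<open>l = 0\<close>
    the factor could not be pulled out.\<close>
  have "0 \<in> ?A" using assms(2) by auto
  then have "?A \<noteq> {}" by blast
  then have "(SUP b\<in>?A. ereal l * ereal ((N bs - N b) / norm (X *v (bs - b))))
      = ereal l * (SUP b\<in>?A. ereal ((N bs - N b) / norm (X *v (bs - b))))"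
    using assms(3) by (intro Sup_ereal_mult_left'[symmetric])
  moreover have "(l * N bs - l * N b) / norm (X *v (bs - b))
      = l * ((N bs - N b) / norm (X *v (bs - b)))" for b
    by (simp add: algebra_simps)
  ultimately show ?thesis
    using assms(1) by (simp only: LSB_def if_False times_ereal.simps)
qed

section \<open>Optimality and stability of the estimator\<close>

text \<open>First-order optimality: comparing \<open>bh\<close> with points of the segment from \<open>bh\<close> to \<open>b\<close>
  and letting them tend to \<open>bh\<close>.\<close>

lemma penalized_estimator_variational:
  fixes X :: "real ^ 'p ^ 'n"
  assumes "is_seminorm h" "penalized_estimator X h y bh"
  shows "(y - X *v bh) \<bullet> (X *v (b - bh)) \<le> h b - h bh"
proof -
  define r where "r = y - X *v bh"
  define w where "w = X *v (b - bh)"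
  have le: "r \<bullet> w - (h b - h bh) \<le> s * ((norm w)\<^sup>2 / 2)" if s: "0 < s" "s \<le> 1" for s
  proof -
    define c where "c = bh + s *\<^sub>R (b - bh)"
    have "(norm (X *v bh - y))\<^sup>2 + 2 * h bh \<le> (norm (X *v c - y))\<^sup>2 + 2 * h c"
      using assms(2) unfolding penalized_estimator_def is_arg_min_def by (auto simp: not_less)
    moreover have "X *v c - y = s *\<^sub>R w - r"
      by (simp add: c_def w_def r_def matrix_vector_right_distrib matrix_vector_mult_scaleR)
    moreover have "X *v bh - y = - r" by (simp add: r_def)
    moreover have "h c \<le> (1 - s) * h bh + s * h b"
    proof -
      have "c = (1 - s) *\<^sub>R bh + s *\<^sub>R b" by (simp add: c_def algebra_simps)
      then show ?thesis
        using seminorm_triangle[OF assms(1), of "(1 - s) *\<^sub>R bh" "s *\<^sub>R b"] s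
        by (simp add: seminorm_scale[OF assms(1)])
    qed
    moreover have "(norm (s *\<^sub>R w - r))\<^sup>2 = s\<^sup>2 * (norm w)\<^sup>2 - 2 * s * (r \<bullet> w) + (norm r)\<^sup>2"
      by (simp only: power2_norm_eq_inner)
        (simp add: inner_diff_left inner_diff_right inner_commute power2_eq_square)
    ultimately have "2 * s * (r \<bullet> w - (h b - h bh)) \<le> s\<^sup>2 * (norm w)\<^sup>2"
      by (simp add: algebra_simps)
    \<comment> \<open>Cancelling the positive factor \<open>2 * s\<close> leaves a right-hand side
      that vanishes as \<open>s\<close> tends to 0.\<close>
    then have "(2 * s) * (r \<bullet> w - (h b - h bh)) \<le> (2 * s) * (s * ((norm w)\<^sup>2 / 2))"
      by (simp add: power2_eq_square)
    then show ?thesis using s(1) by (simp only: mult_le_cancel_left_pos)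
  qed
  have "r \<bullet> w - (h b - h bh) \<le> 0"
  proof (rule tendsto_lowerbound)
    show "((\<lambda>s. s * ((norm w)\<^sup>2 / 2)) \<longlongrightarrow> 0) (at_right (0::real))"
      by (auto intro!: tendsto_eq_intros)
    show "\<forall>\<^sub>F s in at_right (0::real). r \<bullet> w - (h b - h bh) \<le> s * ((norm w)\<^sup>2 / 2)"
      using le by (auto simp: eventually_at_right_field intro!: exI[of _ 1])
  qed simp
  then show ?thesis by (simp add: r_def w_def)
qed

text \<open>Testing each variational inequality at the other estimator and adding makes the
  penalties cancel; Cauchy-Schwarz finishes. Hence the fit is a function of the data even where the
  minimizer is not unique.\<close>

lemma penalized_estimator_nonexpansive:
  fixes X :: "real ^ 'p ^ 'n"
  assumes "is_seminorm h" "penalized_estimator X h y1 b1" "penalized_estimator X h y2 b2"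
  shows "norm (X *v b1 - X *v b2) \<le> norm (y1 - y2)"
proof -
  define d where "d = X *v b1 - X *v b2"
  have "(y1 - X *v b1) \<bullet> (- d) + (y2 - X *v b2) \<bullet> d \<le> 0"
    using penalized_estimator_variational[OF assms(1,2), of b2]
      penalized_estimator_variational[OF assms(1,3), of b1]
    by (simp add: d_def matrix_vector_mult_diff_distrib)
  moreover have "(y1 - X *v b1) \<bullet> (- d) + (y2 - X *v b2) \<bullet> d = d \<bullet> d - (y1 - y2) \<bullet> d"
    by (simp add: d_def inner_diff_left inner_diff_right)
  ultimately have "(norm d)\<^sup>2 \<le> (y1 - y2) \<bullet> d" by (simp add: power2_norm_eq_inner)
  also have "\<dots> \<le> norm (y1 - y2) * norm d" by (rule norm_cauchy_schwarz)
  finally show ?thesis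
    unfolding d_def[symmetric] by (cases "d = 0") (simp_all add: power2_eq_square)
qed

section \<open>Measurability and the risk under centred noise\<close>

text \<open>The range of \<open>g\<close> need not be Borel, so \<open>f\<close> is factored through a Lipschitz map
  on this range rather than on the whole space.\<close>

lemma borel_measurable_nonexpansive:
  fixes f :: "'w \<Rightarrow> 'b::real_normed_vector" and g :: "'w \<Rightarrow> 'c::real_normed_vector"
  assumes g: "g \<in> borel_measurable M"
    and le: "\<And>x y. x \<in> space M \<Longrightarrow> y \<in> space M \<Longrightarrow> norm (f x - f y) \<le> norm (g x - g y)"
  shows "f \<in> borel_measurable M"
proof -
  define A where "A = g ` space M"
  define k where "k = f \<circ> inv_into (space M) g"
  have k: "norm (k u - k v) \<le> norm (u - v)" if "u \<in> A" "v \<in> A" for u v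
    using le[of "inv_into (space M) g u" "inv_into (space M) g v"] that
    by (simp add: k_def A_def inv_into_into f_inv_into_f)
  have "1-lipschitz_on A k"
    by (rule lipschitz_onI) (simp_all add: dist_norm k)
  then have "continuous_on A k" by (rule lipschitz_on_continuous_on)
  then have "k \<in> borel_measurable (restrict_space borel A)"
    by (rule borel_measurable_continuous_on_restrict)
  moreover have "g \<in> measurable M (restrict_space borel A)"
    using g by (intro measurable_restrict_space2) (auto simp: A_def)
  ultimately have "(\<lambda>x. k (g x)) \<in> borel_measurable M"
    by (rule measurable_compose_rev)
  \<comment> \<open>Points with equal \<open>g\<close> have equal \<open>f\<close> by
    \<open>le\<close>, so the choice made by \<open>inv_into\<close> is immaterial.\<close>
  moreover have "k (g x) = f x" if "x \<in> space M" for x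
    using le[of "inv_into (space M) g (g x)" x] that
    by (simp add: k_def inv_into_into f_inv_into_f)
  ultimately show ?thesis by (subst (asm) measurable_cong) auto
qed

lemma penalized_estimator_risk_lower_bound:
  fixes X :: "real ^ 'p ^ 'n" and \<epsilon> :: "'w \<Rightarrow> real ^ 'n"
  assumes h: "is_seminorm h" and m: "minimal_seminorm X h bs"
    and L: "0 \<le> L" "\<And>b. h bs - h b \<le> L * norm (X *v (bs - b))"
    and M: "prob_space M" and eps: "\<epsilon> \<in> borel_measurable M"
    and eps2: "integrable M (\<lambda>\<omega>. (norm (\<epsilon> \<omega>))\<^sup>2)" and eps0: "(LINT \<omega>|M. \<epsilon> \<omega>) = 0"
    and bh: "\<And>\<omega>. \<omega> \<in> space M \<Longrightarrow> penalized_estimator X h (X *v bs + \<epsilon> \<omega>) (bh \<omega>)"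
  shows "h bs - h b \<le> norm (X *v (bs - b)) * (LINT \<omega>|M. norm (X *v (bh \<omega> - bs)))
    + (LINT \<omega>|M. L\<^sup>2 + (norm (\<epsilon> \<omega>))\<^sup>2)"
proof -
  interpret prob_space M by (rule M)
  define D where "D \<omega> = X *v (bh \<omega> - bs)" for \<omega>
  define w where "w = X *v (b - bs)"
  have int_norm: "integrable M (\<lambda>\<omega>. norm (\<epsilon> \<omega>))"
    using square_integrable_imp_integrable[of "\<lambda>\<omega>. norm (\<epsilon> \<omega>)"] eps eps2 by simp
  then have int_eps: "integrable M \<epsilon>"
    using eps by (simp add: integrable_norm_iff)
  \<comment> \<open>Testing at \<open>bs\<close> gives \<open>D_le\<close>, the source of an
    integrable envelope for \<open>D\<close>; testing at \<open>b\<close> gives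
    \<open>gap\<close>.\<close>
  have D_le: "norm (D \<omega>) * norm (D \<omega>) \<le> (L + norm (\<epsilon> \<omega>)) * norm (D \<omega>)"
    and gap: "h bs - h b \<le> D \<omega> \<bullet> w - \<epsilon> \<omega> \<bullet> w + (L\<^sup>2 + (norm (\<epsilon> \<omega>))\<^sup>2)"
    if \<omega>: "\<omega> \<in> space M" for \<omega>
  proof -
    have res: "X *v bs + \<epsilon> \<omega> - X *v bh \<omega> = \<epsilon> \<omega> - D \<omega>"
      by (simp add: D_def matrix_vector_mult_diff_distrib)
    have dir: "X *v (c - bh \<omega>) = X *v (c - bs) - D \<omega>" for c
      by (simp add: D_def matrix_vector_mult_diff_distrib)
    have var: "(\<epsilon> \<omega> - D \<omega>) \<bullet> (X *v (c - bs) - D \<omega>) \<le> h c - h (bh \<omega>)" for c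
      using penalized_estimator_variational[OF h bh[OF \<omega>], of c] unfolding res dir .
    have lip: "h bs - h (bh \<omega>) \<le> L * norm (D \<omega>)"
      using L(2)[of "bh \<omega>"] by (simp add: D_def matrix_vector_mult_diff_distrib norm_minus_commute)
    have cs: "\<epsilon> \<omega> \<bullet> D \<omega> \<le> norm (\<epsilon> \<omega>) * norm (D \<omega>)" by (rule norm_cauchy_schwarz)
    have sq: "D \<omega> \<bullet> D \<omega> = norm (D \<omega>) * norm (D \<omega>)"
      by (simp add: dot_square_norm power2_eq_square)
    show "norm (D \<omega>) * norm (D \<omega>) \<le> (L + norm (\<epsilon> \<omega>)) * norm (D \<omega>)"
      using var[of bs] lip cs sq by (simp add: inner_diff_left algebra_simps)
    have "h bs - h b \<le> D \<omega> \<bullet> w - \<epsilon> \<omega> \<bullet> w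
        + ((L + norm (\<epsilon> \<omega>)) * norm (D \<omega>) - norm (D \<omega>) * norm (D \<omega>))"
      using var[of b] lip cs sq unfolding w_def[symmetric]
      by (simp add: inner_diff_left inner_diff_right algebra_simps)
    moreover have "(L + e) * d - d * d \<le> L\<^sup>2 + e\<^sup>2" for d e :: real
    proof -
      \<comment> \<open>This sum of squares is twice the difference between the two sides.\<close>
      have "0 \<le> ((L - d)\<^sup>2 + (e - d)\<^sup>2 + L\<^sup>2 + e\<^sup>2) / 2" by simp
      also have "\<dots> = L\<^sup>2 + e\<^sup>2 - ((L + e) * d - d * d)"
        by (simp add: power2_eq_square field_simps)
      finally show ?thesis by (simp only: diff_ge_0_iff_ge)
    qed
    ultimately show "h bs - h b \<le> D \<omega> \<bullet> w - \<epsilon> \<omega> \<bullet> w + (L\<^sup>2 + (norm (\<epsilon> \<omega>))\<^sup>2)"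
      by (smt (verit))
  qed
  \<comment> \<open>The selection \<open>bh\<close> may be non-measurable, but \<open>D\<close> is a
    nonexpansive function of the noise since the shift \<open>X *v bs\<close> cancels.\<close>
  have D_meas: "D \<in> borel_measurable M"
  proof (rule borel_measurable_nonexpansive[OF eps])
    fix x y assume "x \<in> space M" "y \<in> space M"
    then show "norm (D x - D y) \<le> norm (\<epsilon> x - \<epsilon> y)"
      using penalized_estimator_nonexpansive[OF h bh bh, of x y]
      by (simp add: D_def matrix_vector_mult_diff_distrib)
  qed
  have D_bound: "norm (D \<omega>) \<le> L + norm (\<epsilon> \<omega>)" if "\<omega> \<in> space M" for \<omega>
    using D_le[OF that] L(1) by (cases "D \<omega> = 0") auto
  \<comment> \<open>Without integrability the integrals of \<open>D\<close> and its norm would take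
    the default value 0.\<close>
  have int_D: "integrable M D"
  proof (rule Bochner_Integration.integrable_bound[OF _ D_meas])
    show "integrable M (\<lambda>\<omega>. L + norm (\<epsilon> \<omega>))" using int_norm by simp
    show "AE \<omega> in M. norm (D \<omega>) \<le> norm (L + norm (\<epsilon> \<omega>))"
      using D_bound L(1) by (intro AE_I2) simp
  qed
  have "h bs - h b = (LINT \<omega>|M. h bs - h b)" by (simp add: prob_space)
  also have "\<dots> \<le> (LINT \<omega>|M. D \<omega> \<bullet> w - \<epsilon> \<omega> \<bullet> w + (L\<^sup>2 + (norm (\<epsilon> \<omega>))\<^sup>2))"
    using int_D int_eps eps2 gap by (intro integral_mono) auto
  \<comment> \<open>The noise term linear in \<open>w\<close> vanishes because the noise is
    centred.\<close>
  also have "\<dots> = (LINT \<omega>|M. D \<omega>) \<bullet> w + (LINT \<omega>|M. L\<^sup>2 + (norm (\<epsilon> \<omega>))\<^sup>2)"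
    using int_D int_eps eps2 eps0 by (simp add: prob_space)
  also have "(LINT \<omega>|M. D \<omega>) \<bullet> w \<le> norm (LINT \<omega>|M. D \<omega>) * norm w"
    by (rule norm_cauchy_schwarz)
  also have "\<dots> \<le> (LINT \<omega>|M. norm (D \<omega>)) * norm w"
    by (intro mult_right_mono integral_norm_bound) simp
  finally show ?thesis
    by (simp add: D_def w_def mult.commute norm_minus_commute matrix_vector_mult_diff_distrib)
qed

text \<open>"Large enough" is understood along the line through \<open>v\<close>: the threshold
  \<open>R\<close> is fixed before \<open>t\<close> and the selection \<open>bh\<close>, but may
  depend on \<open>v\<close>.\<close>

lemma LSB_le_risk:
  fixes X :: "real ^ 'p ^ 'n" and \<epsilon> :: "'w \<Rightarrow> real ^ 'n"
  assumes h: "is_seminorm h" and \<gamma>: "0 < \<gamma>"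
    and M: "prob_space M" and eps: "\<epsilon> \<in> borel_measurable M"
    and eps2: "integrable M (\<lambda>\<omega>. (norm (\<epsilon> \<omega>))\<^sup>2)" and eps0: "(LINT \<omega>|M. \<epsilon> \<omega>) = 0"
  shows "\<exists>R::real. \<forall>t bs bh.
           bs = t *\<^sub>R v \<and> minimal_seminorm X h bs \<and> R \<le> norm (X *v bs) \<and>
           (\<forall>\<omega>\<in>space M. penalized_estimator X h (X *v bs + \<epsilon> \<omega>) (bh \<omega>)) \<longrightarrow>
           ereal (1 - \<gamma>) * LSB X h bs \<le> ereal (LINT \<omega>|M. norm (X *v (bh \<omega> - bs)))"
proof (cases "X *v v \<noteq> 0 \<and> minimal_seminorm X h v")
  case False
  \<comment> \<open>No minimal multiple of \<open>v\<close> has a nonzero image here, so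
    \<open>R = 1\<close> makes the claim vacuous.\<close>
  have "\<not> 1 \<le> norm (X *v (t *\<^sub>R v))" if "minimal_seminorm X h (t *\<^sub>R v)" for t
    using False minimal_seminorm_scaleR[OF h that]
    by (cases "t = 0") (auto simp: matrix_vector_mult_scaleR)
  then show ?thesis by (intro exI[of _ 1]) auto
next
  case True
  then have Xv: "X *v v \<noteq> 0" and v: "minimal_seminorm X h v" "v \<noteq> 0" by auto
  obtain l where l: "LSB X h v = ereal l" "0 \<le> l"
    using LSB_finite[OF h v(1)] LSB_nonneg[OF h Xv] by (cases "LSB X h v") auto
  \<comment> \<open>The bound 1 excludes \<open>t = 0\<close>, where the bias is 0 by
    convention.\<close>
  have LSB_t: "LSB X h (t *\<^sub>R v) = ereal l" if "1 \<le> norm (X *v (t *\<^sub>R v))" for t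
    using LSB_scaleR[OF h, of t X v] that l(1) by (cases "t = 0") auto
  show ?thesis
  proof (cases "(1 - \<gamma>) * l \<le> 0")
    case True
    \<comment> \<open>This covers \<open>\<gamma> \<ge> 1\<close> and \<open>l = 0\<close>: the risk
      is nonnegative.\<close>
    have "(1 - \<gamma>) * l \<le> (LINT \<omega>|M. norm (X *v (bh \<omega> - bs)))" for bh bs
      using True by (rule order_trans) simp
    then show ?thesis using LSB_t by (intro exI[of _ 1]) auto
  next
    case False
    then have "l > 0" using l(2) by (cases "l = 0") auto
    then have "ereal ((1 - \<gamma>) * l) < LSB X h v" using \<gamma> l(1) by simp
    then obtain b where b: "X *v b \<noteq> X *v v"
      "(1 - \<gamma>) * l < (h v - h b) / norm (X *v (v - b))"
      using v(2) unfolding LSB_def by (auto simp: less_SUP_iff)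
    obtain L where L: "0 \<le> L"
      "\<And>bs b. minimal_seminorm X h bs \<Longrightarrow> h bs - h b \<le> L * norm (X *v (bs - b))"
      using minimal_seminorm_lipschitz[OF h] by blast
    define d where "d = norm (X *v (v - b))"
    \<comment> \<open>\<open>c\<close> is the slack of the near-optimal \<open>b\<close>, cleared of
      its denominator. At scale \<open>t\<close> it becomes \<open>\<bar>t\<bar> * c\<close> and
      absorbs the fixed error \<open>K\<close> once \<open>\<bar>t\<bar> \<ge> K / c\<close>, which
      dictates the threshold.\<close>
    define c where "c = (h v - h b) - (1 - \<gamma>) * l * d"
    define K where "K = (LINT \<omega>|M. L\<^sup>2 + (norm (\<epsilon> \<omega>))\<^sup>2)"
    have d: "d > 0" using b(1) by (simp add: d_def matrix_vector_mult_diff_distrib)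
    then have c: "c > 0" using b(2) by (simp add: c_def d_def[symmetric] pos_less_divide_eq)
    have "(1 - \<gamma>) * l \<le> (LINT \<omega>|M. norm (X *v (bh \<omega> - bs)))"
      if bs: "bs = t *\<^sub>R v" "minimal_seminorm X h bs"
        and R: "max 1 (K / c * norm (X *v v)) \<le> norm (X *v bs)"
        and bh: "\<forall>\<omega>\<in>space M. penalized_estimator X h (X *v bs + \<epsilon> \<omega>) (bh \<omega>)"
      for t bs bh
    proof -
      define I where "I = (LINT \<omega>|M. norm (X *v (bh \<omega> - bs)))"
      have nX: "norm (X *v bs) = \<bar>t\<bar> * norm (X *v v)"
        using bs(1) by (simp add: matrix_vector_mult_scaleR)
      then have t: "\<bar>t\<bar> > 0" using R by (cases "t = 0") auto
      have "K / c * norm (X *v v) \<le> \<bar>t\<bar> * norm (X *v v)" using R nX by simp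
      then have "K / c \<le> \<bar>t\<bar>"
        by (rule mult_right_le_imp_le) (simp add: Xv)
      then have K: "K \<le> \<bar>t\<bar> * c" using c by (simp add: pos_divide_le_eq)
      \<comment> \<open>The competitor is scaled together with the signal.\<close>
      have "h bs - h (t *\<^sub>R b) \<le> norm (X *v (bs - t *\<^sub>R b)) * I + K"
        unfolding I_def K_def
        using bh by (intro penalized_estimator_risk_lower_bound[OF h bs(2) L(1) L(2)[OF bs(2)]
              M eps eps2 eps0]) auto
      moreover have "norm (X *v (bs - t *\<^sub>R b)) = \<bar>t\<bar> * d"
        unfolding bs(1) d_def by (simp add: matrix_vector_mult_scaleR flip: scaleR_diff_right)
      moreover have "h bs - h (t *\<^sub>R b) = \<bar>t\<bar> * (h v - h b)"
        unfolding bs(1) by (simp add: seminorm_scale[OF h] algebra_simps)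
      ultimately have "\<bar>t\<bar> * ((1 - \<gamma>) * l * d) \<le> \<bar>t\<bar> * (I * d)"
        using K by (simp add: c_def algebra_simps)
      then have "(1 - \<gamma>) * l \<le> I" using t d by simp
      then show ?thesis by (simp add: I_def)
    qed
    then show ?thesis
      using LSB_t by (intro exI[of _ "max 1 (K / c * norm (X *v v))"]) auto
  qed
qed

section \<open>The noiseless risk\<close>

text \<open>The condition on \<open>bs\<close> matters when the risk is 0: for a nonzero minimal
  \<open>bs\<close> in the kernel of \<open>X\<close>, \<open>h bs = 0\<close>, all quotients are
  nonpositive, and the bias can be negative.\<close>

lemma noiseless_risk_le_LSB:
  fixes X :: "real ^ 'p ^ 'n"
  assumes h: "is_seminorm h" and bs: "bs = 0 \<or> X *v bs \<noteq> 0"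
    and bh: "penalized_estimator X h (X *v bs) bh"
  shows "ereal (norm (X *v (bh - bs))) \<le> LSB X h bs"
proof -
  define D where "D = X *v (bh - bs)"
  have "(- D) \<bullet> (- D) \<le> h bs - h bh"
    using penalized_estimator_variational[OF h bh, of bs]
    by (simp add: D_def matrix_vector_mult_diff_distrib inner_diff_left inner_diff_right)
  then have le: "norm D * norm D \<le> h bs - h bh"
    by (simp add: dot_square_norm power2_eq_square)
  show ?thesis
  proof (cases "D = 0")
    case True
    then show ?thesis
      using bs LSB_nonneg[OF h, of X bs] by (auto simp: D_def[symmetric] LSB_def zero_ereal_def[symmetric])
  next
    case False
    have "bs \<noteq> 0"
    proof
      assume "bs = 0"
      then have "norm D * norm D \<le> 0"
        using le seminorm_zero[OF h] seminorm_nonneg[OF h, of bh] by simp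
      then show False using False by (simp add: mult_le_0_iff)
    qed
    have eq: "norm (X *v (bs - bh)) = norm D"
      by (simp add: D_def matrix_vector_mult_diff_distrib norm_minus_commute)
    \<comment> \<open>Since \<open>D\<close> is nonzero, \<open>bh\<close> itself is an admissible
      competitor in the supremum.\<close>
    have "norm D \<le> (h bs - h bh) / norm D"
      using le False by (simp add: pos_le_divide_eq)
    also have "ereal \<dots> \<le> LSB X h bs"
      using LSB_upper[OF \<open>bs \<noteq> 0\<close>, of X bh h] False
      by (simp add: eq) (simp add: D_def matrix_vector_mult_diff_distrib)
    finally show ?thesis by (simp add: D_def)
  qed
qed

section \<open>Monotonicity in the penalty level\<close>

text \<open>If \<open>X *v bs = 0\<close>, then minimality forces \<open>l * N bs = 0\<close>, so \<open>0\<close> is the only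
  admissible value of \<open>l\<close>.\<close>

lemma LSB_strict_mono_on_cmult:
  fixes X :: "real ^ 'p ^ 'n"
  assumes N: "is_norm N" and bs: "bs \<noteq> 0"
  shows "strict_mono_on {l. 0 \<le> l \<and> minimal_seminorm X (\<lambda>b. l * N b) bs}
    (\<lambda>l. LSB X (\<lambda>b. l * N b) bs)"
proof (rule strict_mono_onI)
  fix l l' :: real
  assume l: "l \<in> {l. 0 \<le> l \<and> minimal_seminorm X (\<lambda>b. l * N b) bs}"
    and l': "l' \<in> {l. 0 \<le> l \<and> minimal_seminorm X (\<lambda>b. l * N b) bs}" and "l < l'"
  have sN: "is_seminorm N" using N by (simp add: is_norm_def)
  have "N bs \<noteq> 0" using N bs by (auto simp: is_norm_def)
  then have Npos: "N bs > 0" using seminorm_nonneg[OF sN, of bs] by simp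
  have pos: "0 < l'" using l \<open>l < l'\<close> by simp
  have m: "minimal_seminorm X N bs"
    using l' pos by (simp add: minimal_seminorm_iff)
  have "X *v bs \<noteq> 0"
  proof
    assume "X *v bs = 0"
    then have "N bs \<le> N 0" using m unfolding minimal_seminorm_iff by auto
    then show False using Npos seminorm_zero[OF sN] by simp
  qed
  then have "0 < ereal (N bs / norm (X *v bs))" using Npos by simp
  also have "\<dots> \<le> LSB X N bs" by (rule LSB_ge_ratio[OF sN \<open>X *v bs \<noteq> 0\<close>])
  finally have "0 < LSB X N bs" .
  \<comment> \<open>With \<open>s\<close> positive and finite, the bias at level \<open>l\<close> is
    \<open>l * s\<close>, hence strictly increasing.\<close>
  then obtain s where s: "LSB X N bs = ereal s" "0 < s"
    using LSB_finite[OF sN m] by (cases "LSB X N bs") auto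
  show "LSB X (\<lambda>b. l * N b) bs < LSB X (\<lambda>b. l' * N b) bs"
    using LSB_cmult[OF bs \<open>X *v bs \<noteq> 0\<close>] l l' s \<open>l < l'\<close> by simp
qed

section \<open>The five properties together\<close>

theorem proposition2p2:
  fixes X :: "real ^ 'p ^ 'n" and h :: "real ^ 'p \<Rightarrow> real"
  assumes "is_seminorm h"
  shows
    "(\<forall>bs. bs \<noteq> 0 \<and> minimal_seminorm X h bs \<longrightarrow>
        (X *v bs \<noteq> 0 \<longrightarrow> ereal (h bs / norm (X *v bs)) \<le> LSB X h bs) \<and>
        LSB X h bs < \<infinity>)
     \<and>
     (\<forall>bs t. minimal_seminorm X h bs \<and> t \<noteq> 0 \<longrightarrow> LSB X h (t *\<^sub>R bs) = LSB X h bs)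
     \<and>
     (\<forall>(\<gamma>::real) (M :: 'w measure) (\<epsilon> :: 'w \<Rightarrow> real ^ 'n).
        0 < \<gamma> \<and> prob_space M \<and> \<epsilon> \<in> borel_measurable M \<and>
        integrable M (\<lambda>\<omega>. (norm (\<epsilon> \<omega>))\<^sup>2) \<and> (LINT \<omega>|M. \<epsilon> \<omega>) = 0 \<longrightarrow>
        (\<forall>v. \<exists>R::real. \<forall>t bs bh.
           bs = t *\<^sub>R v \<and> minimal_seminorm X h bs \<and> R \<le> norm (X *v bs) \<and>
           (\<forall>\<omega>\<in>space M. penalized_estimator X h (X *v bs + \<epsilon> \<omega>) (bh \<omega>)) \<longrightarrow>
           ereal (1 - \<gamma>) * LSB X h bs \<le> ereal (LINT \<omega>|M. norm (X *v (bh \<omega> - bs)))))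
     \<and>
     (\<forall>bs bh. minimal_seminorm X h bs \<and> (bs = 0 \<or> X *v bs \<noteq> 0) \<and>
        penalized_estimator X h (X *v bs) bh \<longrightarrow>
        ereal (norm (X *v (bh - bs))) \<le> LSB X h bs)
     \<and>
     (\<forall>N bs. is_norm N \<longrightarrow>
        (let \<Lambda> = {l::real. 0 \<le> l \<and> minimal_seminorm X (\<lambda>b. l * N b) bs} in
           mono_on \<Lambda> (\<lambda>l. LSB X (\<lambda>b. l * N b) bs) \<and>
           (bs \<noteq> 0 \<longrightarrow> strict_mono_on \<Lambda> (\<lambda>l. LSB X (\<lambda>b. l * N b) bs))))"
proof (intro conjI)
  show "\<forall>bs. bs \<noteq> 0 \<and> minimal_seminorm X h bs \<longrightarrow>
        (X *v bs \<noteq> 0 \<longrightarrow> ereal (h bs / norm (X *v bs)) \<le> LSB X h bs) \<and> LSB X h bs < \<infinity>"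
    using LSB_ge_ratio[OF assms] LSB_finite[OF assms] by blast
  show "\<forall>bs t. minimal_seminorm X h bs \<and> t \<noteq> 0 \<longrightarrow> LSB X h (t *\<^sub>R bs) = LSB X h bs"
    using LSB_scaleR[OF assms] by blast
  show "\<forall>(\<gamma>::real) (M :: 'w measure) (\<epsilon> :: 'w \<Rightarrow> real ^ 'n).
        0 < \<gamma> \<and> prob_space M \<and> \<epsilon> \<in> borel_measurable M \<and>
        integrable M (\<lambda>\<omega>. (norm (\<epsilon> \<omega>))\<^sup>2) \<and> (LINT \<omega>|M. \<epsilon> \<omega>) = 0 \<longrightarrow>
        (\<forall>v. \<exists>R::real. \<forall>t bs bh.
           bs = t *\<^sub>R v \<and> minimal_seminorm X h bs \<and> R \<le> norm (X *v bs) \<and>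
           (\<forall>\<omega>\<in>space M. penalized_estimator X h (X *v bs + \<epsilon> \<omega>) (bh \<omega>)) \<longrightarrow>
           ereal (1 - \<gamma>) * LSB X h bs \<le> ereal (LINT \<omega>|M. norm (X *v (bh \<omega> - bs))))"
    by (intro allI impI LSB_le_risk[OF assms]) simp_all
  show "\<forall>bs bh. minimal_seminorm X h bs \<and> (bs = 0 \<or> X *v bs \<noteq> 0) \<and>
        penalized_estimator X h (X *v bs) bh \<longrightarrow>
        ereal (norm (X *v (bh - bs))) \<le> LSB X h bs"
    using noiseless_risk_le_LSB[OF assms] by blast
  show "\<forall>N bs. is_norm N \<longrightarrow>
        (let \<Lambda> = {l::real. 0 \<le> l \<and> minimal_seminorm X (\<lambda>b. l * N b) bs} in
           mono_on \<Lambda> (\<lambda>l. LSB X (\<lambda>b. l * N b) bs) \<and>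
           (bs \<noteq> 0 \<longrightarrow> strict_mono_on \<Lambda> (\<lambda>l. LSB X (\<lambda>b. l * N b) bs)))"
    unfolding Let_def
  proof (intro allI impI conjI)
    fix N :: "real ^ 'p \<Rightarrow> real" and bs :: "real ^ 'p"
    assume N: "is_norm N"
    show "mono_on {l. 0 \<le> l \<and> minimal_seminorm X (\<lambda>b. l * N b) bs} (\<lambda>l. LSB X (\<lambda>b. l * N b) bs)"
    \<comment> \<open>At \<open>bs = 0\<close> the bias is constantly 0, so only weak monotonicity
      survives.\<close>
    proof (cases "bs = 0")
      case True
      then show ?thesis by (simp add: LSB_def mono_on_def)
    next
      case False
      then show ?thesis using LSB_strict_mono_on_cmult[OF N] strict_mono_on_imp_mono_on by blast
    qed
  qed (rule LSB_strict_mono_on_cmult)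
qed

end
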